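(* Let $\Delta$ be a $d$-dimensional fan in $\mathbb{R}^d$ and $w\in\operatorname{MW}_d(\Delta)$. Choose a sufficiently general vector $v_0\in\mathbb{R}^d$ and let $\tilde\Delta$ be the fan generated by the cones of $\Delta$ together with, for each $\tau\in\Delta_{d-1}$, the $d$-dimensional cone $\sigma_\tau$ generated by $\tau$ and $v_0$. For $\sigma\in\Delta_d$ let $\Delta_\sigma\subseteq\tilde\Delta$ be the subfan with maximal cones $\sigma$ and $\sigma_\tau$ for all $(d-1)$-dimensional faces $\tau$ of $\sigma$. Then for each $\sigma\in\Delta_d$ there is a unique Minkowski weight $u^\sigma\in\operatorname{MW}_d(\Delta_\sigma)$ with $u^\sigma_\sigma=w_\sigma$, and, regarding all Minkowski weights on subfans as Minkowski weights on $\tilde\Delta$ by extension by zero, \[w=\sum_{\sigma\in\Delta_d}u^\sigma.\]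
   Context: A fan in $\mathbb{R}^d$: a pure $d$-dimensional abstract simplicial fan with ray vectors in $\mathbb{R}^d$ linearly independent on each cone (cones identified with the cones spanned; overlaps of cones are allowed in this abstract setting). $\Delta_j$ is the set of $j$-cones. $\operatorname{MW}_d(\Delta)$: vectors $(w_\sigma)_{\sigma\in\Delta_d}$ such that for each $(d-1)$-cone $\tau$, with $\sigma_1,\ldots,\sigma_t$ the $d$-cones containing $\tau$ and $u_k$ the generator of $\sigma_k$ not in $\tau$, $\sum_kw_{\sigma_k}u_k$ lies in the span of $\tau$. *)

theory Defs
  imports "HOL-Analysis.Analysis"
begin

definition cones :: "nat \<Rightarrow> 'v set set \<Rightarrow> 'v set set" where
  "cones j \<Delta> = {\<sigma> \<in> \<Delta>. card \<sigma> = j}"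

text \<open>
  A cone is recorded as the set of its rays. Rays are abstract elements of type \<open>'v\<close>, and
  \<open>\<rho>\<close> assigns to each ray its vector in \<open>\<real>\<^sup>d\<close>, where \<open>d = CARD('n)\<close>. Nothing
  prevents the spanned cones from overlapping, or distinct rays from having the same vector, as
  long as they do not lie in a common cone.
\<close>
definition fan :: "'v set set \<Rightarrow> ('v \<Rightarrow> real ^ 'n) \<Rightarrow> bool" where
  "fan \<Delta> \<rho> \<longleftrightarrow>
     finite \<Delta> \<and> {} \<in> \<Delta> \<and>
     (\<forall>\<sigma>\<in>\<Delta>. \<forall>\<tau>. \<tau> \<subseteq> \<sigma> \<longrightarrow> \<tau> \<in> \<Delta>) \<and>
     (\<forall>\<tau>\<in>\<Delta>. \<exists>\<sigma>\<in>cones CARD('n) \<Delta>. \<tau> \<subseteq> \<sigma>) \<and>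
     (\<forall>\<sigma>\<in>\<Delta>. inj_on \<rho> \<sigma> \<and> independent (\<rho> ` \<sigma>))"

text \<open>
  A weight on the \<open>d\<close>-cones of \<open>\<Delta>\<close> is a function on all sets of rays that vanishes off the
  \<open>d\<close>-cones. Extension by zero from a subfan to a larger fan therefore does not change the
  function. For \<open>\<tau> \<subseteq> \<sigma>\<close> of codimension one, \<open>the_elem (\<sigma> - \<tau>)\<close> is the ray of \<open>\<sigma>\<close> not in \<open>\<tau>\<close>.
\<close>
definition MW :: "'v set set \<Rightarrow> ('v \<Rightarrow> real ^ 'n) \<Rightarrow> ('v set \<Rightarrow> real) set" where
  "MW \<Delta> \<rho> = {w.
     (\<forall>\<sigma>. \<sigma> \<notin> cones CARD('n) \<Delta> \<longrightarrow> w \<sigma> = 0) \<and>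
     (\<forall>\<tau>\<in>cones (CARD('n) - 1) \<Delta>.
        (\<Sum>\<sigma> | \<sigma> \<in> cones CARD('n) \<Delta> \<and> \<tau> \<subseteq> \<sigma>. w \<sigma> *\<^sub>R \<rho> (the_elem (\<sigma> - \<tau>)))
          \<in> span (\<rho> ` \<tau>))}"

definition generated_by :: "'v set set \<Rightarrow> 'v set set" where
  "generated_by M = {\<kappa>. \<exists>\<sigma>\<in>M. \<kappa> \<subseteq> \<sigma>}"

text \<open>
  In the next two definitions \<open>p\<close> is a new ray, whose vector will be \<open>v\<^sub>0\<close>; the cone
  \<open>\<sigma>\<^sub>\<tau>\<close> generated by \<open>\<tau>\<close> and \<open>v\<^sub>0\<close> is \<open>insert p \<tau>\<close>. The argument \<open>d\<close> is the dimension.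
\<close>
definition tilde_fan :: "nat \<Rightarrow> 'v set set \<Rightarrow> 'v \<Rightarrow> 'v set set" where
  "tilde_fan d \<Delta> p = generated_by (\<Delta> \<union> insert p ` cones (d - 1) \<Delta>)"

definition local_fan :: "nat \<Rightarrow> 'v set \<Rightarrow> 'v \<Rightarrow> 'v set set" where
  "local_fan d \<sigma> p = generated_by (insert \<sigma> (insert p ` {\<tau>. \<tau> \<subseteq> \<sigma> \<and> card \<tau> = d - 1}))"

text \<open>
  \<open>P v\<close> holds for every sufficiently general \<open>v\<close>: for all \<open>v\<close> outside some finite union of
  proper linear subspaces.
\<close>
definition for_general :: "(real ^ 'n \<Rightarrow> bool) \<Rightarrow> bool" where
  "for_general P \<longleftrightarrow>
     (\<exists>\<H>. finite \<H> \<and> (\<forall>H\<in>\<H>. subspace H \<and> H \<noteq> UNIV) \<and> (\<forall>v. v \<notin> \<Union>\<H> \<longrightarrow> P v))"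

end

theory Submission
  imports Defs
begin

text \<open>
  The local fan at \<open>\<sigma>\<close> is the boundary of the simplex \<open>S = \<sigma> \<union> {p}\<close>. Generality of \<open>v\<^sub>0\<close> says
  that all coefficients of the linear relation \<open>\<Sum>x\<in>S. c x *\<^sub>R \<rho> x = 0\<close> are nonzero, and giving
  \<open>S - {x}\<close> the weight \<open>k / c x\<close> is balanced: around \<open>S - {x, y}\<close> the balancing sum is
  \<open>k / (c x * c y)\<close> times \<open>c x *\<^sub>R \<rho> x + c y *\<^sub>R \<rho> y\<close>, which the relation puts in the span of the
  remaining rays. Conversely, a Minkowski weight is determined by its values on the \<open>d\<close>-cones
  without \<open>p\<close>, because \<open>\<rho> p\<close> is not in the span of a \<open>(d-1)\<close>-cone \<open>\<tau>\<close> with \<open>\<tau> \<union> {p}\<close> a cone. This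
  gives both the uniqueness of \<open>u\<^sup>\<sigma>\<close> and the decomposition of \<open>w\<close>, as \<open>u\<^sup>\<sigma>\<close> vanishes on every
  \<open>d\<close>-cone of \<open>\<Delta>\<close> other than \<open>\<sigma>\<close>.
\<close>

section \<open>Cones of a fan as independent sets of rays\<close>

lemma fan_cone_finite:
  assumes "fan \<Delta> \<rho>" "\<sigma> \<in> \<Delta>"
  shows "finite \<sigma>"
proof -
  have "independent (\<rho> ` \<sigma>)" "inj_on \<rho> \<sigma>" using assms by (auto simp: fan_def)
  then show ?thesis using independent_imp_finite finite_imageD by blast
qed

lemma fan_not_in_span:
  assumes "fan \<Delta> \<rho>" "\<sigma> \<in> \<Delta>" "x \<in> \<sigma>" "A \<subseteq> \<sigma> - {x}"
  shows "\<rho> x \<notin> span (\<rho> ` A)"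
proof -
  have ind: "independent (\<rho> ` \<sigma>)" and inj: "inj_on \<rho> \<sigma>" using assms by (auto simp: fan_def)
  have "\<rho> x \<notin> span (\<rho> ` \<sigma> - {\<rho> x})" using ind assms(3) by (auto simp: dependent_def)
  moreover have "\<rho> ` A \<subseteq> \<rho> ` \<sigma> - {\<rho> x}" using inj assms(3,4) by (auto dest: inj_onD)
  ultimately show ?thesis using span_mono by blast
qed

text \<open>Wherever \<open>MW\<close> applies \<open>the_elem\<close> to
  \<open>\<sigma> - \<tau>\<close>, this shows that a single ray is left, so that
  \<open>the_elem\<close> has a definite value.\<close>

lemma codim_one_diff_singleton:
  assumes "finite \<sigma>" "\<tau> \<subseteq> \<sigma>" "card \<sigma> = Suc (card \<tau>)"
  obtains x where "\<sigma> - \<tau> = {x}"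
proof -
  have "card (\<sigma> - \<tau>) = 1" using assms by (simp add: card_Diff_subset finite_subset)
  then show ?thesis using that by (auto simp: card_1_singleton_iff)
qed

section \<open>Vector space structure, change of rays and extension by zero\<close>

lemma MW_0: "(\<lambda>_. 0) \<in> MW \<Delta> \<rho>"
  by (simp add: MW_def span_zero)

lemma MW_add:
  assumes "u \<in> MW \<Delta> \<rho>" "v \<in> MW \<Delta> \<rho>"
  shows "(\<lambda>\<kappa>. u \<kappa> + v \<kappa>) \<in> MW \<Delta> \<rho>"
  using assms by (auto simp: MW_def scaleR_add_left sum.distrib intro: span_add)

lemma MW_diff:
  assumes "u \<in> MW \<Delta> \<rho>" "v \<in> MW \<Delta> \<rho>"
  shows "(\<lambda>\<kappa>. u \<kappa> - v \<kappa>) \<in> MW \<Delta> \<rho>"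
  using assms by (auto simp: MW_def scaleR_diff_left sum_subtractf intro: span_diff)

lemma MW_sum:
  assumes "\<And>i. i \<in> I \<Longrightarrow> u i \<in> MW \<Delta> \<rho>"
  shows "(\<lambda>\<kappa>. \<Sum>i\<in>I. u i \<kappa>) \<in> MW \<Delta> \<rho>"
  using assms by (induction I rule: infinite_finite_induct) (auto simp: MW_0 intro: MW_add)

text \<open>The balancing condition evaluates the ray map only at rays of \<open>\<tau>\<close> and
  at the one ray of \<open>\<sigma> - \<tau>\<close>, all of which lie in
  \<open>\<Union>\<Delta>\<close>. This lets \<open>\<rho>\<close> be replaced by
  \<open>\<rho>(p := v0)\<close> for a new ray \<open>p\<close>.\<close>

lemma MW_cong:
  fixes \<rho> \<rho>' :: "'v \<Rightarrow> real ^ 'n"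
  assumes "\<And>x. x \<in> \<Union>\<Delta> \<Longrightarrow> \<rho> x = \<rho>' x"
  shows "MW \<Delta> \<rho> = MW \<Delta> \<rho>'"
proof -
  have "\<rho> (the_elem (\<sigma> - \<tau>)) = \<rho>' (the_elem (\<sigma> - \<tau>))"
    if "\<tau> \<in> cones (CARD('n) - 1) \<Delta>" "\<sigma> \<in> cones CARD('n) \<Delta>" "\<tau> \<subseteq> \<sigma>" for \<sigma> \<tau>
  proof -
    \<comment> \<open>Finiteness is read off from \<open>card \<sigma> = CARD('n)\<close>, which is
      positive; positivity also makes the truncated \<open>CARD('n) - 1\<close> a true
      predecessor.\<close>
    have "finite \<sigma>" "card \<sigma> = Suc (card \<tau>)"
      using that by (auto simp: cones_def intro: card_ge_0_finite)
    then obtain x where x: "\<sigma> - \<tau> = {x}"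
      using codim_one_diff_singleton[OF _ \<open>\<tau> \<subseteq> \<sigma>\<close>] by blast
    have "x \<in> \<Union>\<Delta>" using x that(2) unfolding cones_def by blast
    from assms[OF this] show ?thesis unfolding x by simp
  qed
  then have "(\<Sum>\<sigma> | \<sigma> \<in> cones CARD('n) \<Delta> \<and> \<tau> \<subseteq> \<sigma>. w \<sigma> *\<^sub>R \<rho> (the_elem (\<sigma> - \<tau>))) =
      (\<Sum>\<sigma> | \<sigma> \<in> cones CARD('n) \<Delta> \<and> \<tau> \<subseteq> \<sigma>. w \<sigma> *\<^sub>R \<rho>' (the_elem (\<sigma> - \<tau>)))"
    if "\<tau> \<in> cones (CARD('n) - 1) \<Delta>" for w \<tau>
    using that by (intro sum.cong) auto
  moreover have "\<rho> ` \<tau> = \<rho>' ` \<tau>" if "\<tau> \<in> cones (CARD('n) - 1) \<Delta>" for \<tau>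
    using that assms by (intro image_cong) (auto simp: cones_def)
  ultimately show ?thesis by (simp add: MW_def)
qed

text \<open>Extension by zero preserves balancing. Around a \<open>\<tau>\<close> in
  \<open>\<Delta>\<close> the additional cones of \<open>T\<close> contribute zero terms; around a
  \<open>\<tau>\<close> outside \<open>\<Delta>\<close> every term is zero, because a cone of
  \<open>\<Delta>\<close> containing \<open>\<tau>\<close> would force
  \<open>\<tau> \<in> \<Delta>\<close>.\<close>

lemma MW_mono:
  fixes \<rho> :: "'v \<Rightarrow> real ^ 'n"
  assumes "finite T" "\<Delta> \<subseteq> T" and down: "\<And>\<sigma> \<tau>. \<sigma> \<in> \<Delta> \<Longrightarrow> \<tau> \<subseteq> \<sigma> \<Longrightarrow> \<tau> \<in> \<Delta>"
  shows "MW \<Delta> \<rho> \<subseteq> MW T \<rho>"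
proof
  fix w assume w: "w \<in> MW \<Delta> \<rho>"
  then have w0: "w \<sigma> = 0" if "\<sigma> \<notin> cones CARD('n) \<Delta>" for \<sigma> using that by (simp add: MW_def)
  have sub: "cones j \<Delta> \<subseteq> cones j T" for j using assms(2) by (auto simp: cones_def)
  have "(\<Sum>\<sigma> | \<sigma> \<in> cones CARD('n) T \<and> \<tau> \<subseteq> \<sigma>. w \<sigma> *\<^sub>R \<rho> (the_elem (\<sigma> - \<tau>))) \<in> span (\<rho> ` \<tau>)"
    if "\<tau> \<in> cones (CARD('n) - 1) T" for \<tau>
  proof -
    have eq: "(\<Sum>\<sigma> | \<sigma> \<in> cones CARD('n) T \<and> \<tau> \<subseteq> \<sigma>. w \<sigma> *\<^sub>R \<rho> (the_elem (\<sigma> - \<tau>))) =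
        (\<Sum>\<sigma> | \<sigma> \<in> cones CARD('n) \<Delta> \<and> \<tau> \<subseteq> \<sigma>. w \<sigma> *\<^sub>R \<rho> (the_elem (\<sigma> - \<tau>)))"
      using assms(1) sub w0 by (intro sum.mono_neutral_right) (auto simp: cones_def)
    show ?thesis
    proof (cases "\<tau> \<in> \<Delta>")
      case True
      then have "\<tau> \<in> cones (CARD('n) - 1) \<Delta>" using that by (simp add: cones_def)
      then show ?thesis using w unfolding eq by (simp add: MW_def)
    next
      case False
      then have none: "{\<sigma> \<in> cones CARD('n) \<Delta>. \<tau> \<subseteq> \<sigma>} = {}" using down by (auto simp: cones_def)
      show ?thesis unfolding eq none by (simp add: span_zero)
    qed
  qed
  then show "w \<in> MW T \<rho>" using w0 sub by (auto simp: MW_def)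
qed

section \<open>Weights are determined by the cones that avoid one ray\<close>

text \<open>For a \<open>d\<close>-cone \<open>\<kappa>\<close> through \<open>p\<close>, balance
  around the facet \<open>\<tau> = \<kappa> - {p}\<close>. By cardinality \<open>\<kappa>\<close> is
  the only \<open>d\<close>-cone that contains both \<open>\<tau>\<close> and \<open>p\<close>, and
  the others carry weight zero, so the sum collapses to
  \<open>u \<kappa> *\<^sub>R \<rho> p\<close>. Independence of \<open>\<kappa>\<close> then forces
  \<open>u \<kappa> = 0\<close>.\<close>

lemma MW_eq_0_if_0_off_ray:
  fixes \<rho> :: "'v \<Rightarrow> real ^ 'n"
  assumes fan: "fan T \<rho>" and u: "u \<in> MW T \<rho>"
    and off: "\<And>\<kappa>. \<kappa> \<in> cones CARD('n) T \<Longrightarrow> p \<notin> \<kappa> \<Longrightarrow> u \<kappa> = 0"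
  shows "u \<kappa> = 0"
proof (cases "\<kappa> \<in> cones CARD('n) T \<and> p \<in> \<kappa>")
  case False
  then show ?thesis using u off by (auto simp: MW_def)
next
  case True
  then have \<kappa>: "\<kappa> \<in> T" "card \<kappa> = CARD('n)" "p \<in> \<kappa>" by (auto simp: cones_def)
  have fin: "finite \<kappa>" using fan_cone_finite[OF fan \<kappa>(1)] .
  have finT: "finite T" using fan by (simp add: fan_def)
  define \<tau> where "\<tau> = \<kappa> - {p}"
  have \<tau>: "\<tau> \<in> cones (CARD('n) - 1) T"
    using fan \<kappa> fin unfolding \<tau>_def cones_def fan_def by auto
  have "\<sigma> = \<kappa>" if "\<sigma> \<in> cones CARD('n) T" "\<tau> \<subseteq> \<sigma>" "p \<in> \<sigma>" for \<sigma>
  proof -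
    have "\<kappa> \<subseteq> \<sigma>" using that by (auto simp: \<tau>_def)
    moreover have "finite \<sigma>" "card \<sigma> = card \<kappa>"
      using that \<kappa> fan by (auto simp: cones_def intro: fan_cone_finite)
    ultimately show ?thesis using card_subset_eq by metis
  qed
  then have "(\<Sum>\<sigma> | \<sigma> \<in> cones CARD('n) T \<and> \<tau> \<subseteq> \<sigma>. u \<sigma> *\<^sub>R \<rho> (the_elem (\<sigma> - \<tau>))) =
      (\<Sum>\<sigma>\<in>{\<kappa>}. u \<sigma> *\<^sub>R \<rho> (the_elem (\<sigma> - \<tau>)))"
    using finT True off
    by (intro sum.mono_neutral_right) (auto simp: cones_def \<tau>_def)
  also have "\<kappa> - \<tau> = {p}" using \<kappa> by (auto simp: \<tau>_def)
  then have "(\<Sum>\<sigma>\<in>{\<kappa>}. u \<sigma> *\<^sub>R \<rho> (the_elem (\<sigma> - \<tau>))) = u \<kappa> *\<^sub>R \<rho> p" by simp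
  finally have "u \<kappa> *\<^sub>R \<rho> p \<in> span (\<rho> ` \<tau>)" using u \<tau> by (auto simp: MW_def)
  moreover have "\<rho> p \<notin> span (\<rho> ` \<tau>)"
    using fan_not_in_span[OF fan \<kappa>(1) \<kappa>(3)] by (simp add: \<tau>_def)
  ultimately show ?thesis using span_scale[of "u \<kappa> *\<^sub>R \<rho> p" "\<rho> ` \<tau>" "inverse (u \<kappa>)"]
    by (cases "u \<kappa> = 0") auto
qed

section \<open>Minkowski weights on the boundary of a simplex\<close>

text \<open>Any facet \<open>S - {p}\<close> gives a basis of the whole space, and expanding
  \<open>\<rho> p\<close> in it yields the relation. If the coefficient at some \<open>x\<close>
  were zero, \<open>\<rho> p\<close> would lie in the span of \<open>S - {p, x}\<close>, although
  \<open>S - {x}\<close> is an independent cone containing \<open>p\<close>.\<close>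

lemma simplex_boundary_relation:
  fixes \<rho> :: "'v \<Rightarrow> real ^ 'n"
  assumes fan: "fan {\<kappa>. \<kappa> \<subset> S} \<rho>" and S: "finite S" "card S = Suc CARD('n)"
  obtains c where "(\<Sum>x\<in>S. c x *\<^sub>R \<rho> x) = 0" "\<And>x. x \<in> S \<Longrightarrow> c x \<noteq> 0"
proof -
  obtain p where p: "p \<in> S" using S by fastforce
  let ?B = "S - {p}"
  have B: "?B \<in> {\<kappa>. \<kappa> \<subset> S}" "finite ?B" "card ?B = CARD('n)" using p S by auto
  have ind: "independent (\<rho> ` ?B)" and inj: "inj_on \<rho> ?B" using fan B(1) by (auto simp: fan_def)
  have "card (\<rho> ` ?B) = DIM(real ^ 'n)" using B inj by (simp add: card_image)
  then have "span (\<rho> ` ?B) = UNIV"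
    using ind B by (metis card_eq_dim dim_UNIV dim_eq_full finite_imageI dim_eq_card_independent)
  then have "\<rho> p \<in> span (\<rho> ` ?B)" by simp
  then obtain b where "\<rho> p = (\<Sum>v\<in>\<rho> ` ?B. b v *\<^sub>R v)"
    using B span_finite[of "\<rho> ` ?B"] by auto
  \<comment> \<open>\<open>span_finite\<close> indexes the coefficients by vectors; injectivity of
    \<open>\<rho>\<close> on the facet reindexes them by rays.\<close>
  then have b: "\<rho> p = (\<Sum>x\<in>?B. b (\<rho> x) *\<^sub>R \<rho> x)"
    using inj by (simp add: sum.reindex)
  define c where "c x = (if x = p then -1 else b (\<rho> x))" for x
  have b': "\<rho> p = (\<Sum>x\<in>?B. c x *\<^sub>R \<rho> x)"
    using b by (simp add: c_def)
  show ?thesis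
  proof
    show "(\<Sum>x\<in>S. c x *\<^sub>R \<rho> x) = 0"
      using b' by (subst sum.remove[OF S(1) p]) (simp add: c_def)
    fix x assume x: "x \<in> S"
    show "c x \<noteq> 0"
    proof
      assume 0: "c x = 0"
      then have xp: "x \<noteq> p" by (auto simp: c_def)
      have "\<rho> p = (\<Sum>y\<in>S - {p, x}. c y *\<^sub>R \<rho> y)"
        unfolding b' using S 0 by (intro sum.mono_neutral_right) auto
      also have "\<dots> \<in> span (\<rho> ` (S - {p, x}))"
        by (intro span_sum span_scale span_base) auto
      finally show False
        using fan_not_in_span[OF fan, of "S - {x}" p "S - {p, x}"] x p xp by auto
    qed
  qed
qed

lemma simplex_boundary_MW_exists:
  fixes \<rho> :: "'v \<Rightarrow> real ^ 'n"
  assumes fan: "fan {\<kappa>. \<kappa> \<subset> S} \<rho>" and S: "finite S" "card S = Suc CARD('n)" and p: "p \<in> S"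
  obtains u where "u \<in> MW {\<kappa>. \<kappa> \<subset> S} \<rho>" "u (S - {p}) = a"
proof -
  obtain c where c: "(\<Sum>x\<in>S. c x *\<^sub>R \<rho> x) = 0" and c0: "\<And>x. x \<in> S \<Longrightarrow> c x \<noteq> 0"
    using simplex_boundary_relation[OF fan S] by metis
  let ?C = "cones CARD('n) {\<kappa>. \<kappa> \<subset> S}"
  \<comment> \<open>The scale is chosen so that the facet \<open>S - {p}\<close> receives the weight
    \<open>k / c p = a\<close>.\<close>
  define k where "k = a * c p"
  define u where "u \<kappa> = (if \<kappa> \<in> ?C then k / c (the_elem (S - \<kappa>)) else 0)" for \<kappa>
  have C: "S - {x} \<in> ?C" if "x \<in> S" for x
    using that S by (auto simp: cones_def)
  have u: "u (S - {x}) = k / c x" if "x \<in> S" for x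
  proof -
    have "S - (S - {x}) = {x}" using that by auto
    then show ?thesis using C[OF that] by (simp add: u_def)
  qed
  have "(\<Sum>\<sigma> | \<sigma> \<in> ?C \<and> \<tau> \<subseteq> \<sigma>. u \<sigma> *\<^sub>R \<rho> (the_elem (\<sigma> - \<tau>))) \<in> span (\<rho> ` \<tau>)"
    if "\<tau> \<in> cones (CARD('n) - 1) {\<kappa>. \<kappa> \<subset> S}" for \<tau>
  proof -
    have \<tau>: "\<tau> \<subseteq> S" "card \<tau> = CARD('n) - 1" using that by (auto simp: cones_def)
    have "card (S - \<tau>) = 2" using \<tau> S by (simp add: card_Diff_subset finite_subset)
    then obtain x y where xy: "S - \<tau> = {x, y}" "x \<noteq> y" by (auto simp: card_2_iff)
    have xyS: "x \<in> S" "y \<in> S" using xy by auto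
    have d: "S - {x} - \<tau> = {y}" "S - {y} - \<tau> = {x}" using xy by auto
    \<comment> \<open>Every facet of the simplex omits one ray, and it contains
      \<open>\<tau>\<close> exactly if this ray is one of the two missing from
      \<open>\<tau>\<close>.\<close>
    have "{\<sigma>. \<sigma> \<in> ?C \<and> \<tau> \<subseteq> \<sigma>} = {S - {x}, S - {y}}"
    proof (intro equalityI subsetI)
      fix \<sigma> assume "\<sigma> \<in> {\<sigma>. \<sigma> \<in> ?C \<and> \<tau> \<subseteq> \<sigma>}"
      then have \<sigma>: "\<sigma> \<subset> S" "card \<sigma> = CARD('n)" "\<tau> \<subseteq> \<sigma>" by (auto simp: cones_def)
      obtain z where z: "S - \<sigma> = {z}" using \<sigma> S codim_one_diff_singleton[of S \<sigma>] by auto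
      then have "z \<in> {x, y}" "\<sigma> = S - {z}" using \<sigma> xy by auto
      then show "\<sigma> \<in> {S - {x}, S - {y}}" by auto
    next
      fix \<sigma> assume "\<sigma> \<in> {S - {x}, S - {y}}"
      then show "\<sigma> \<in> {\<sigma>. \<sigma> \<in> ?C \<and> \<tau> \<subseteq> \<sigma>}" using C xyS xy \<tau> by auto
    qed
    moreover have "S - {x} \<noteq> S - {y}" using xy xyS by auto
    ultimately have "(\<Sum>\<sigma> | \<sigma> \<in> ?C \<and> \<tau> \<subseteq> \<sigma>. u \<sigma> *\<^sub>R \<rho> (the_elem (\<sigma> - \<tau>))) =
        (k / c x) *\<^sub>R \<rho> y + (k / c y) *\<^sub>R \<rho> x"
      using xyS by (simp add: d u)
    \<comment> \<open>The weight \<open>k / c x\<close> of \<open>S - {x}\<close> multiplies the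
      opposite ray \<open>y\<close>. Over the common denominator, which is nonzero, it becomes
      \<open>k * c y / (c x * c y)\<close>, so each ray meets its own coefficient of the
      relation.\<close>
    also have "\<dots> = (k / (c x * c y)) *\<^sub>R (c x *\<^sub>R \<rho> x + c y *\<^sub>R \<rho> y)"
      using c0 xyS by (simp add: scaleR_add_right)
    also have "c x *\<^sub>R \<rho> x + c y *\<^sub>R \<rho> y = - (\<Sum>z\<in>\<tau>. c z *\<^sub>R \<rho> z)"
    proof -
      have "(\<Sum>z\<in>S. c z *\<^sub>R \<rho> z) = (\<Sum>z\<in>S - \<tau>. c z *\<^sub>R \<rho> z) + (\<Sum>z\<in>\<tau>. c z *\<^sub>R \<rho> z)"
        using sum.subset_diff[OF \<tau>(1) S(1)] .
      then show ?thesis using c xy by (simp add: eq_neg_iff_add_eq_0)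
    qed
    also have "(k / (c x * c y)) *\<^sub>R - (\<Sum>z\<in>\<tau>. c z *\<^sub>R \<rho> z) \<in> span (\<rho> ` \<tau>)"
      by (intro span_scale span_neg span_sum span_base) auto
    finally show ?thesis .
  qed
  then have "u \<in> MW {\<kappa>. \<kappa> \<subset> S} \<rho>" by (simp add: MW_def u_def)
  moreover have "u (S - {p}) = a" using p c0 by (simp add: u k_def)
  ultimately show ?thesis using that by blast
qed

section \<open>The local fans and the enlarged fan\<close>

lemma generated_by_mono: "M \<subseteq> N \<Longrightarrow> generated_by M \<subseteq> generated_by N"
  unfolding generated_by_def by blast

lemma generated_by_subset: "\<sigma> \<in> generated_by M \<Longrightarrow> \<tau> \<subseteq> \<sigma> \<Longrightarrow> \<tau> \<in> generated_by M"
  unfolding generated_by_def by blast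

text \<open>A proper subset of \<open>insert p \<sigma>\<close> omits \<open>p\<close>, and is then
  a face of \<open>\<sigma>\<close>, or omits some \<open>x \<in> \<sigma>\<close>, and is then a
  face of the cone over \<open>\<sigma> - {x}\<close>.\<close>

lemma local_fan_eq_simplex_boundary:
  assumes "finite \<sigma>" "card \<sigma> = d" "0 < d" "p \<notin> \<sigma>"
  shows "local_fan d \<sigma> p = {\<kappa>. \<kappa> \<subset> insert p \<sigma>}"
proof (intro equalityI subsetI)
  fix \<kappa> assume "\<kappa> \<in> local_fan d \<sigma> p"
  then consider "\<kappa> \<subseteq> \<sigma>" | \<tau> where "\<tau> \<subseteq> \<sigma>" "card \<tau> = d - 1" "\<kappa> \<subseteq> insert p \<tau>"
    unfolding local_fan_def generated_by_def by blast
  then show "\<kappa> \<in> {\<kappa>. \<kappa> \<subset> insert p \<sigma>}"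
  proof cases
    case 1
    then show ?thesis using assms(4) by auto
  next
    case 2
    \<comment> \<open>Here \<open>0 < d\<close> matters: for \<open>d = 0\<close> truncated
      subtraction would give \<open>d - 1 = d\<close>.\<close>
    then have "\<tau> \<noteq> \<sigma>" using assms by auto
    then show ?thesis using 2 assms(4) by auto
  qed
next
  fix \<kappa> assume "\<kappa> \<in> {\<kappa>. \<kappa> \<subset> insert p \<sigma>}"
  then obtain x where x: "\<kappa> \<subseteq> insert p \<sigma>" "x \<in> insert p \<sigma>" "x \<notin> \<kappa>" by auto
  show "\<kappa> \<in> local_fan d \<sigma> p"
  proof (cases "x = p")
    case True
    then show ?thesis using x by (auto simp: local_fan_def generated_by_def)
  next
    case False
    then have "\<kappa> \<subseteq> insert p (\<sigma> - {x})" "card (\<sigma> - {x}) = d - 1" using x assms by auto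
    then show ?thesis unfolding local_fan_def generated_by_def by blast
  qed
qed

lemma fan_simplex_boundary:
  fixes \<rho> :: "'v \<Rightarrow> real ^ 'n"
  assumes "fan T \<rho>" "{\<kappa>. \<kappa> \<subset> S} \<subseteq> T" "finite S" "card S = Suc CARD('n)"
  shows "fan {\<kappa>. \<kappa> \<subset> S} \<rho>"
  unfolding fan_def
proof (intro conjI ballI allI impI)
  show "finite {\<kappa>. \<kappa> \<subset> S}" using assms by (auto intro: finite_subset[of _ "Pow S"])
  show "{} \<in> {\<kappa>. \<kappa> \<subset> S}" using assms by auto
  fix \<sigma> assume \<sigma>: "\<sigma> \<in> {\<kappa>. \<kappa> \<subset> S}"
  then have "\<sigma> \<in> T" using assms(2) by blast
  then show "inj_on \<rho> \<sigma>" "independent (\<rho> ` \<sigma>)" using assms(1) by (simp_all add: fan_def)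
  show "\<exists>\<kappa>\<in>cones CARD('n) {\<kappa>. \<kappa> \<subset> S}. \<sigma> \<subseteq> \<kappa>"
  proof -
    obtain x where "x \<in> S" "x \<notin> \<sigma>" using \<sigma> by auto
    then show ?thesis using \<sigma> assms by (intro bexI[of _ "S - {x}"]) (auto simp: cones_def)
  qed
  show "\<tau> \<in> {\<kappa>. \<kappa> \<subset> S}" if "\<tau> \<subseteq> \<sigma>" for \<tau> using that \<sigma> by auto
qed

text \<open>Generality of \<open>v\<close> enters the proof here: it makes the new cones
  \<open>insert p \<tau>\<close> independent. The nonvanishing of the coefficients on the local fans
  later follows from their cones being cones of this fan.\<close>

lemma fan_tilde_fan:
  fixes \<rho> :: "'v \<Rightarrow> real ^ 'n"
  assumes fan: "fan \<Delta> \<rho>" and p: "p \<notin> \<Union>\<Delta>"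
    and v: "\<And>\<tau>. \<tau> \<in> cones (CARD('n) - 1) \<Delta> \<Longrightarrow> v \<notin> span (\<rho> ` \<tau>)"
  shows "fan (tilde_fan CARD('n) \<Delta> p) (\<rho>(p := v))"
proof -
  let ?T = "tilde_fan CARD('n) \<Delta> p" and ?M = "\<Delta> \<union> insert p ` cones (CARD('n) - 1) \<Delta>"
  let ?\<rho> = "\<rho>(p := v)"
  have img: "?\<rho> ` \<sigma> = \<rho> ` \<sigma>" if "\<sigma> \<in> \<Delta>" for \<sigma>
    using that p by (intro image_cong) auto
  \<comment> \<open>It suffices to treat the generating cones, since all three properties pass to
    subsets.\<close>
  have indM: "inj_on ?\<rho> \<sigma> \<and> independent (?\<rho> ` \<sigma>) \<and> finite \<sigma>" if "\<sigma> \<in> ?M" for \<sigma>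
    using that
  proof
    assume s: "\<sigma> \<in> \<Delta>"
    have "inj_on ?\<rho> \<sigma> \<longleftrightarrow> inj_on \<rho> \<sigma>" using s p by (intro inj_on_cong) auto
    then show ?thesis using img[OF s] s fan fan_cone_finite[OF fan s] by (simp add: fan_def)
  next
    assume "\<sigma> \<in> insert p ` cones (CARD('n) - 1) \<Delta>"
    then obtain \<tau> where \<tau>: "\<tau> \<in> cones (CARD('n) - 1) \<Delta>" "\<sigma> = insert p \<tau>" by auto
    then have t: "\<tau> \<in> \<Delta>" "p \<notin> \<tau>" using p by (auto simp: cones_def)
    have "inj_on ?\<rho> \<tau> \<longleftrightarrow> inj_on \<rho> \<tau>" using t by (intro inj_on_cong) auto
    then have inj: "inj_on ?\<rho> \<tau>" and ind: "independent (\<rho> ` \<tau>)" using t fan by (auto simp: fan_def)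
    have nv: "v \<notin> span (\<rho> ` \<tau>)" using v \<tau> by blast
    have nv': "v \<notin> \<rho> ` \<tau>" using nv span_base[of v "\<rho> ` \<tau>"] by blast
    have "?\<rho> ` \<sigma> = insert v (\<rho> ` \<tau>)" unfolding \<tau>(2) image_insert img[OF t(1)] by simp
    then have "independent (?\<rho> ` \<sigma>)" using ind nv nv' by (simp add: independent_insert)
    moreover have "inj_on ?\<rho> \<sigma>"
      using inj nv' img[OF t(1)] t(2) unfolding \<tau>(2) by (subst inj_on_insert) simp
    moreover have "finite \<sigma>" using \<tau>(2) fan_cone_finite[OF fan t(1)] by simp
    ultimately show ?thesis by blast
  qed
  have Tdef: "?T = {\<kappa>. \<exists>\<sigma>\<in>?M. \<kappa> \<subseteq> \<sigma>}" by (simp add: tilde_fan_def generated_by_def)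
  show ?thesis unfolding fan_def
  proof (intro conjI ballI allI impI)
    have finM: "finite ?M" using fan by (auto simp: fan_def cones_def)
    have Teq: "?T = (\<Union>\<sigma>\<in>?M. Pow \<sigma>)" unfolding Tdef by auto
    show "finite ?T"
      unfolding Teq by (intro finite_UN_I finM) (simp only: finite_Pow_iff indM)
    show "{} \<in> ?T" using fan unfolding Tdef by (auto simp: fan_def)
    fix \<kappa> assume "\<kappa> \<in> ?T"
    then obtain \<sigma> where \<sigma>: "\<sigma> \<in> ?M" "\<kappa> \<subseteq> \<sigma>" unfolding Tdef by auto
    show "inj_on ?\<rho> \<kappa>" using indM[OF \<sigma>(1)] \<sigma>(2) inj_on_subset by metis
    show "independent (?\<rho> ` \<kappa>)"
      using indM[OF \<sigma>(1)] image_mono[OF \<sigma>(2)] independent_mono by metis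
    show "\<tau> \<in> ?T" if "\<tau> \<subseteq> \<kappa>" for \<tau> using \<sigma> that unfolding Tdef by blast
    show "\<exists>\<sigma>\<in>cones CARD('n) ?T. \<kappa> \<subseteq> \<sigma>" using \<sigma>(1)
    proof
      assume "\<sigma> \<in> \<Delta>"
      then obtain \<sigma>' where "\<sigma>' \<in> cones CARD('n) \<Delta>" "\<sigma> \<subseteq> \<sigma>'" using fan by (auto simp: fan_def)
      then show ?thesis using \<sigma>(2) unfolding Tdef by (intro bexI[of _ \<sigma>']) (auto simp: cones_def)
    next
      assume s: "\<sigma> \<in> insert p ` cones (CARD('n) - 1) \<Delta>"
      then obtain \<tau> where \<tau>: "\<tau> \<in> \<Delta>" "card \<tau> = CARD('n) - 1" "\<sigma> = insert p \<tau>"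
        by (auto simp: cones_def)
      then have "card \<sigma> = CARD('n)" using p fan_cone_finite[OF fan \<tau>(1)] by auto
      moreover have "\<sigma> \<in> ?T" using \<sigma>(1) unfolding Tdef by blast
      ultimately show ?thesis using \<sigma>(2) by (auto simp: cones_def)
    qed
  qed
qed

section \<open>Local weights and the decomposition for general \<open>v0\<close>\<close>

theorem theorem4p5:
  fixes \<Delta> :: "'v set set" and \<rho> :: "'v \<Rightarrow> real ^ 'n" and w :: "'v set \<Rightarrow> real" and p :: 'v
  assumes "fan \<Delta> \<rho>" and "w \<in> MW \<Delta> \<rho>" and "p \<notin> \<Union>\<Delta>"
  shows "for_general (\<lambda>v0 :: real ^ 'n.
    let d = CARD('n); \<rho>' = \<rho>(p := v0); T = tilde_fan d \<Delta> p; L = (\<lambda>\<sigma>. local_fan d \<sigma> p) in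
      fan T \<rho>' \<and> w \<in> MW T \<rho>' \<and>
      (\<forall>\<sigma>\<in>cones d \<Delta>. fan (L \<sigma>) \<rho>' \<and> L \<sigma> \<subseteq> T \<and> MW (L \<sigma>) \<rho>' \<subseteq> MW T \<rho>' \<and>
         (\<exists>!u. u \<in> MW (L \<sigma>) \<rho>' \<and> u \<sigma> = w \<sigma>)) \<and>
      (\<forall>u. (\<forall>\<sigma>\<in>cones d \<Delta>. u \<sigma> \<in> MW (L \<sigma>) \<rho>' \<and> u \<sigma> \<sigma> = w \<sigma>) \<longrightarrow>
         w = (\<lambda>\<kappa>. \<Sum>\<sigma>\<in>cones d \<Delta>. u \<sigma> \<kappa>)))"
proof -
  let ?d = "CARD('n)"
  let ?T = "tilde_fan ?d \<Delta> p" and ?L = "\<lambda>\<sigma>. local_fan ?d \<sigma> p"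
  \<comment> \<open>The subspaces to avoid are the spans of the \<open>(d-1)\<close>-cones: finitely
    many, and proper because each is spanned by fewer than \<open>d\<close> vectors.\<close>
  let ?\<H> = "(\<lambda>\<tau>. span (\<rho> ` \<tau>)) ` cones (?d - 1) \<Delta>"
  have fin: "finite (cones j \<Delta>)" for j using assms(1) by (simp add: fan_def cones_def)
  have proper: "span (\<rho> ` \<tau>) \<noteq> UNIV" if "\<tau> \<in> cones (?d - 1) \<Delta>" for \<tau>
  proof -
    have "finite \<tau>" "card \<tau> < ?d"
      using that assms(1) by (auto simp: cones_def intro: fan_cone_finite)
    then have "dim (span (\<rho> ` \<tau>)) < DIM(real ^ 'n)"
      using dim_le_card[of "\<rho> ` \<tau>" "\<rho> ` \<tau>"] card_image_le[of \<tau> \<rho>] span_superset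
      by fastforce
    then show ?thesis by (metis dim_UNIV less_irrefl)
  qed
  have concl: "fan ?T \<rho>' \<and> w \<in> MW ?T \<rho>' \<and>
      (\<forall>\<sigma>\<in>cones ?d \<Delta>. fan (?L \<sigma>) \<rho>' \<and> ?L \<sigma> \<subseteq> ?T \<and> MW (?L \<sigma>) \<rho>' \<subseteq> MW ?T \<rho>' \<and>
         (\<exists>!u. u \<in> MW (?L \<sigma>) \<rho>' \<and> u \<sigma> = w \<sigma>)) \<and>
      (\<forall>u. (\<forall>\<sigma>\<in>cones ?d \<Delta>. u \<sigma> \<in> MW (?L \<sigma>) \<rho>' \<and> u \<sigma> \<sigma> = w \<sigma>) \<longrightarrow>
         w = (\<lambda>\<kappa>. \<Sum>\<sigma>\<in>cones ?d \<Delta>. u \<sigma> \<kappa>))"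
    if v: "v \<notin> \<Union>?\<H>" and \<rho>': "\<rho>' = \<rho>(p := v)" for v \<rho>'
  proof -
    have fanT: "fan ?T \<rho>'"
      unfolding \<rho>' using v by (intro fan_tilde_fan assms) auto
    then have finT: "finite ?T" by (simp add: fan_def)
    have "MW \<Delta> \<rho> = MW \<Delta> \<rho>'" using assms(3) by (intro MW_cong) (auto simp: \<rho>')
    moreover have "MW \<Delta> \<rho>' \<subseteq> MW ?T \<rho>'"
      using assms(1) by (intro MW_mono finT) (auto simp: tilde_fan_def generated_by_def fan_def)
    ultimately have wT: "w \<in> MW ?T \<rho>'" using assms(2) by auto
    \<comment> \<open>A face of \<open>insert p \<tau>\<close> that avoids \<open>p\<close> is
      already a face of \<open>\<tau>\<close>, so the enlarged fan has no new cones without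
      \<open>p\<close>.\<close>
    have p_free: "\<kappa> \<in> cones ?d \<Delta>" if "\<kappa> \<in> cones ?d ?T" "p \<notin> \<kappa>" for \<kappa>
    proof -
      from that obtain \<tau> where "\<tau> \<in> \<Delta>" "\<kappa> \<subseteq> \<tau>"
        by (auto simp: cones_def tilde_fan_def generated_by_def)
      then show ?thesis using that assms(1) by (auto simp: cones_def fan_def)
    qed
    have L: "?L \<sigma> = {\<kappa>. \<kappa> \<subset> insert p \<sigma>}" "finite \<sigma>" "p \<notin> \<sigma>" "card \<sigma> = ?d"
      if "\<sigma> \<in> cones ?d \<Delta>" for \<sigma>
    proof -
      show "finite \<sigma>" "p \<notin> \<sigma>" "card \<sigma> = ?d"
        using that assms(1,3) by (auto simp: cones_def intro: fan_cone_finite)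
      then show "?L \<sigma> = {\<kappa>. \<kappa> \<subset> insert p \<sigma>}" by (intro local_fan_eq_simplex_boundary) auto
    qed
    have LT: "?L \<sigma> \<subseteq> ?T" if "\<sigma> \<in> cones ?d \<Delta>" for \<sigma>
    proof -
      have "\<sigma> \<in> \<Delta>" using that by (simp add: cones_def)
      moreover from this have "{\<tau>. \<tau> \<subseteq> \<sigma> \<and> card \<tau> = ?d - 1} \<subseteq> cones (?d - 1) \<Delta>"
        using assms(1) by (auto simp: cones_def fan_def)
      ultimately have "insert \<sigma> (insert p ` {\<tau>. \<tau> \<subseteq> \<sigma> \<and> card \<tau> = ?d - 1}) \<subseteq>
          \<Delta> \<union> insert p ` cones (?d - 1) \<Delta>"
        by (simp add: image_mono le_supI2)
      then show ?thesis unfolding local_fan_def tilde_fan_def by (rule generated_by_mono)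
    qed
    have MWT: "MW (?L \<sigma>) \<rho>' \<subseteq> MW ?T \<rho>'" if "\<sigma> \<in> cones ?d \<Delta>" for \<sigma>
    proof (rule MW_mono[OF finT LT[OF that]])
      show "\<tau> \<in> ?L \<sigma>" if "\<kappa> \<in> ?L \<sigma>" "\<tau> \<subseteq> \<kappa>" for \<kappa> \<tau>
        using that generated_by_subset unfolding local_fan_def by metis
    qed
    \<comment> \<open>The facet \<open>\<sigma>\<close> opposite to \<open>p\<close> is the only
      \<open>d\<close>-cone of the local fan without \<open>p\<close>. Hence
      \<open>u \<sigma>\<close> alone determines a local weight, and distinct local weights do not
      interfere on the \<open>d\<close>-cones of \<open>\<Delta>\<close>.\<close>
    have off: "u \<kappa> = 0"
      if "\<sigma> \<in> cones ?d \<Delta>" "u \<in> MW (?L \<sigma>) \<rho>'" "p \<notin> \<kappa>" "\<kappa> \<noteq> \<sigma>" for u \<sigma> \<kappa>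
    proof -
      have "\<kappa> \<notin> cones ?d (?L \<sigma>)"
      proof
        assume "\<kappa> \<in> cones ?d (?L \<sigma>)"
        then have "\<kappa> \<subseteq> \<sigma>" "card \<kappa> = card \<sigma>" using L[OF that(1)] that(3) by (auto simp: cones_def)
        then show False using L(2)[OF that(1)] that(4) card_subset_eq by metis
      qed
      then show ?thesis using that(2) by (simp add: MW_def)
    qed
    have fanL: "fan (?L \<sigma>) \<rho>'" if "\<sigma> \<in> cones ?d \<Delta>" for \<sigma>
      unfolding L(1)[OF that]
      using L[OF that] LT[OF that] by (intro fan_simplex_boundary[OF fanT]) auto
    have ex1: "\<exists>!u. u \<in> MW (?L \<sigma>) \<rho>' \<and> u \<sigma> = w \<sigma>" if \<sigma>: "\<sigma> \<in> cones ?d \<Delta>" for \<sigma>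
    proof (rule ex_ex1I)
      have eq: "insert p \<sigma> - {p} = \<sigma>" using L[OF \<sigma>] by auto
      show "\<exists>u. u \<in> MW (?L \<sigma>) \<rho>' \<and> u \<sigma> = w \<sigma>"
        using simplex_boundary_MW_exists[of "insert p \<sigma>" \<rho>' p "w \<sigma>"] fanL[OF \<sigma>] L[OF \<sigma>]
        unfolding eq by (metis card_insert_disjoint finite_insert insertI1)
    next
      fix u1 u2
      assume u1: "u1 \<in> MW (?L \<sigma>) \<rho>' \<and> u1 \<sigma> = w \<sigma>" and u2: "u2 \<in> MW (?L \<sigma>) \<rho>' \<and> u2 \<sigma> = w \<sigma>"
      have "u1 \<kappa> - u2 \<kappa> = 0" for \<kappa>
      proof (rule MW_eq_0_if_0_off_ray[OF fanL[OF \<sigma>]])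
        show "(\<lambda>\<kappa>. u1 \<kappa> - u2 \<kappa>) \<in> MW (?L \<sigma>) \<rho>'" using u1 u2 by (auto intro: MW_diff)
        show "u1 \<kappa> - u2 \<kappa> = 0" if "p \<notin> \<kappa>" for \<kappa>
          using u1 u2 off[OF \<sigma> _ that, of u1] off[OF \<sigma> _ that, of u2] by (cases "\<kappa> = \<sigma>") simp_all
      qed
      then show "u1 = u2" by (simp add: fun_eq_iff)
    qed
    have "w = (\<lambda>\<kappa>. \<Sum>\<sigma>\<in>cones ?d \<Delta>. u \<sigma> \<kappa>)"
      if u: "\<forall>\<sigma>\<in>cones ?d \<Delta>. u \<sigma> \<in> MW (?L \<sigma>) \<rho>' \<and> u \<sigma> \<sigma> = w \<sigma>" for u
    proof -
      \<comment> \<open>The difference is a Minkowski weight on the enlarged fan, so it need only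
        vanish on \<open>d\<close>-cones \<open>\<kappa>\<close> without \<open>p\<close>. These
        belong to \<open>\<Delta>\<close>, and there only the summand
        \<open>\<sigma> = \<kappa>\<close> survives, with value \<open>w \<kappa>\<close>.\<close>
      have "w \<kappa> - (\<Sum>\<sigma>\<in>cones ?d \<Delta>. u \<sigma> \<kappa>) = 0" for \<kappa>
      proof (rule MW_eq_0_if_0_off_ray[OF fanT])
        show "(\<lambda>\<kappa>. w \<kappa> - (\<Sum>\<sigma>\<in>cones ?d \<Delta>. u \<sigma> \<kappa>)) \<in> MW ?T \<rho>'"
          using u MWT by (intro MW_diff MW_sum wT) auto
        fix \<kappa> assume "\<kappa> \<in> cones ?d ?T" and p: "p \<notin> \<kappa>"
        then have \<kappa>: "\<kappa> \<in> cones ?d \<Delta>" by (rule p_free)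
        have zero: "u \<sigma> \<kappa> = 0" if "\<sigma> \<in> cones ?d \<Delta>" "\<sigma> \<noteq> \<kappa>" for \<sigma>
          using off[OF that(1) _ p, of "u \<sigma>"] u that by simp
        have "(\<Sum>\<sigma>\<in>cones ?d \<Delta>. u \<sigma> \<kappa>) = (\<Sum>\<sigma>\<in>{\<kappa>}. u \<sigma> \<kappa>)"
          using fin \<kappa> zero by (intro sum.mono_neutral_right) auto
        then show "w \<kappa> - (\<Sum>\<sigma>\<in>cones ?d \<Delta>. u \<sigma> \<kappa>) = 0" using u \<kappa> by simp
      qed
      then show ?thesis by (simp add: fun_eq_iff)
    qed
    then show ?thesis using fanT wT fanL LT MWT ex1 by blast
  qed
  show ?thesis
    unfolding for_general_def Let_def
    using fin proper concl by (intro exI[of _ ?\<H>] conjI allI impI) auto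
qed

end
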